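(* Let $n\ge1$ and let $\mathcal{A}^B_n$ be the set of $B$-arc permutations in $B_n$. Then $$\sum_{\pi\in \mathcal{A}^B_n} q^{\mathrm{fmaj}(\pi)}=[2n]_q\prod_{i=1}^{n-1} (1+q^{2i-1}),\qquad \sum_{\pi\in \mathcal{A}^B_n} \mathrm{sign}(\pi) q^{\mathrm{fmaj}(\pi)}=[2n]_{(-1)^nq} \prod_{i=1}^{n-1}(1+(-1)^{i}q^{2i-1}),$$ $$\sum_{\pi\in \mathcal{A}^B_n} (-1)^{\mathrm{neg}(\pi)} q^{\mathrm{fmaj}(\pi)}=[2n]_{-q} \prod_{i=1}^{n-1} (1-q^{2i-1}),\qquad \sum_{\pi\in \mathcal{A}^B_n} \mathrm{sign}(|\pi|) q^{\mathrm{fmaj}(\pi)}=[2n]_{(-1)^{n-1}q} \prod_{i=1}^{n-1} (1+(-1)^{i-1}q^{2i-1}).$$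
   Context: $B_n$ is the group of bijections $\pi$ of $\{\pm1,\dots,\pm n\}$ with $\pi(-a)=-\pi(a)$, written $\pi=[\pi(1),\dots,\pi(n)]$. Let $\mathcal{O}_n$ be a circle with $2n$ points labeled $-1,\dots,-n,1,\dots,n$ in clockwise order; an interval in $\mathcal{O}_n$ is a set of cyclically consecutive points. $\pi\in B_n$ is a $B$-arc permutation if for every $1\le j\le n$ the set $\{\pi(j),\dots,\pi(n)\}$ is an interval in $\mathcal{O}_n$. Descents are with respect to the order $-1<-2<\cdots<-n<1<\cdots<n$: $\mathrm{Des}(\pi)=\{1\le i\le n-1:\pi(i)>\pi(i+1)\}$, $\mathrm{maj}(\pi)=\sum_{i\in\mathrm{Des}(\pi)}i$, $\mathrm{neg}(\pi)=\#\{i:\pi(i)<0\}$, $\mathrm{fmaj}(\pi)=2\,\mathrm{maj}(\pi)+\mathrm{neg}(\pi)$. $|\pi|\in S_n$ is $|\pi(1)|\cdots|\pi(n)|$, $\mathrm{sign}(|\pi|)=(-1)^{\mathrm{inv}(|\pi|)}$, and $\mathrm{sign}(\pi)=(-1)^{\mathrm{neg}(\pi)}\mathrm{sign}(|\pi|)$ is the sign character of $B_n$. $[m]_z=1+z+\dots+z^{m-1}$. *)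

theory Defs
  imports Complex_Main "HOL-Combinatorics.Permutations"
begin

text \<open>The hyperoctahedral group \<open>B\<^sub>n\<close>; \<open>permutes\<close> makes its elements total functions on
  the integers that fix every point outside \<open>{\<plusminus>1, \<dots>, \<plusminus>n}\<close>.\<close>

definition hyperoctahedral :: "nat \<Rightarrow> (int \<Rightarrow> int) set" where
  "hyperoctahedral n =
     {\<pi>. \<pi> permutes ({- int n..int n} - {0}) \<and> (\<forall>a. \<pi> (- a) = - \<pi> a)}"

text \<open>\<open>circle_point n k\<close> is the label reached after \<open>k\<close> clockwise steps from the label \<open>-1\<close> on the
  circle labelled \<open>-1, \<dots>, -n, 1, \<dots>, n\<close>; it is periodic in \<open>k\<close> with period \<open>2 * n\<close>.\<close>

definition circle_point :: "nat \<Rightarrow> nat \<Rightarrow> int" where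
  "circle_point n k =
     (let r = k mod (2 * n) in if r < n then - (int r + 1) else int r - int n + 1)"

definition circle_interval :: "nat \<Rightarrow> int set \<Rightarrow> bool" where
  "circle_interval n A \<longleftrightarrow> (\<exists>s l. A = (\<lambda>i. circle_point n (s + i)) ` {..<l})"

definition B_arc_perms :: "nat \<Rightarrow> (int \<Rightarrow> int) set" where
  "B_arc_perms n =
     {\<pi> \<in> hyperoctahedral n. \<forall>j\<in>{1..n}. circle_interval n ((\<lambda>i. \<pi> (int i)) ` {j..n})}"

text \<open>The order \<open>-1 < -2 < \<dots> < -n < 1 < \<dots> < n\<close>.\<close>

definition B_less :: "int \<Rightarrow> int \<Rightarrow> bool" where
  "B_less a b \<longleftrightarrow> (if a < 0 \<and> b < 0 then b < a else a < b)"

definition Des :: "nat \<Rightarrow> (int \<Rightarrow> int) \<Rightarrow> nat set" where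
  "Des n \<pi> = {i. 1 \<le> i \<and> i \<le> n - 1 \<and> B_less (\<pi> (int (i + 1))) (\<pi> (int i))}"

definition maj :: "nat \<Rightarrow> (int \<Rightarrow> int) \<Rightarrow> nat" where
  "maj n \<pi> = \<Sum> (Des n \<pi>)"

definition neg :: "nat \<Rightarrow> (int \<Rightarrow> int) \<Rightarrow> nat" where
  "neg n \<pi> = card {i \<in> {1..n}. \<pi> (int i) < 0}"

definition fmaj :: "nat \<Rightarrow> (int \<Rightarrow> int) \<Rightarrow> nat" where
  "fmaj n \<pi> = 2 * maj n \<pi> + neg n \<pi>"

definition abs_perm :: "(int \<Rightarrow> int) \<Rightarrow> nat \<Rightarrow> nat" where
  "abs_perm \<pi> i = nat \<bar>\<pi> (int i)\<bar>"

definition inversions :: "nat \<Rightarrow> (nat \<Rightarrow> nat) \<Rightarrow> nat" where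
  "inversions n \<sigma> = card {(i, j). 1 \<le> i \<and> i < j \<and> j \<le> n \<and> \<sigma> i > \<sigma> j}"

definition inv_sign :: "nat \<Rightarrow> (nat \<Rightarrow> nat) \<Rightarrow> int" where
  "inv_sign n \<sigma> = (-1) ^ inversions n \<sigma>"

definition B_sign :: "nat \<Rightarrow> (int \<Rightarrow> int) \<Rightarrow> int" where
  "B_sign n \<pi> = (-1) ^ neg n \<pi> * inv_sign n (abs_perm \<pi>)"

definition q_bracket :: "nat \<Rightarrow> 'a::comm_ring_1 \<Rightarrow> 'a" where
  "q_bracket m z = (\<Sum>i<m. z ^ i)"

end

theory Submission
  imports Defs
begin

text \<open>One counterclockwise step of the circle, applied to the values of a signed permutation,
  raises \<open>fmaj\<close> by 1, flips the parity of \<open>neg\<close> and changes the sign of \<open>|\<pi>|\<close> by that of an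
  \<open>n\<close>-cycle, unless \<open>\<pi>(n) = -1\<close>. Hence each rotation orbit of arc permutations is a run of \<open>2n\<close>
  consecutive values of \<open>fmaj\<close> starting at the element with \<open>\<pi>(n) = n\<close>, which gives the factor
  \<open>[2n]\<close>. An arc permutation with \<open>\<pi>(n) = n\<close> is an arc permutation of \<open>B\<^sub>n\<^sub>-\<^sub>1\<close> ending in one of the
  two circle neighbours \<open>n - 1\<close> and \<open>-1\<close> of \<open>n\<close>; these are the two ends of an orbit of the smaller
  circle, so they differ by \<open>2(n - 1) - 1\<close> steps, which gives the factor \<open>1 \<plusminus> q^(2(n-1)-1)\<close>.
  All four identities are the cases \<open>x, y = \<plusminus>1\<close> of one weighted identity.\<close>

definition ccw :: "nat \<Rightarrow> int \<Rightarrow> int" where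
  "ccw n a = (if a = -1 then int n else if a = 1 then - int n
     else if 1 < a \<and> a \<le> int n then a - 1
     else if - int n \<le> a \<and> a < -1 then a + 1 else a)"

definition weight :: "'a::comm_ring_1 \<Rightarrow> 'a \<Rightarrow> 'a \<Rightarrow> nat \<Rightarrow> (int \<Rightarrow> int) \<Rightarrow> 'a" where
  "weight x y q n \<pi> = x ^ neg n \<pi> * y ^ inversions n (abs_perm \<pi>) * q ^ fmaj n \<pi>"

definition arcs_ending :: "nat \<Rightarrow> int \<Rightarrow> (int \<Rightarrow> int) set" where
  "arcs_ending n a = {\<pi> \<in> B_arc_perms n. \<pi> (int n) = a}"

text \<open>The \<open>a\<close> points just before and the \<open>b\<close> points just after the boundary between \<open>n\<close> and \<open>-1\<close>.
  As a set of labels it becomes an arc of the next larger circle on inserting \<open>n + 1\<close>.\<close>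

definition arc :: "nat \<Rightarrow> nat \<Rightarrow> nat \<Rightarrow> int set" where
  "arc n a b = {- int b..-1} \<union> {int n + 1 - int a..int n}"

section \<open>The circle, its counterclockwise step, and rotation of arc permutations\<close>

lemma circle_point_ccw:
  assumes "n \<ge> 1"
  shows "ccw n (circle_point n (Suc k)) = circle_point n k"
proof -
  define r where "r = k mod (2 * n)"
  have "r < 2 * n" using assms by (simp add: r_def)
  then show ?thesis
    using assms by (auto simp: ccw_def circle_point_def Let_def mod_Suc simp flip: r_def)
qed

lemma circle_point_add_period: "circle_point n (k + 2 * n) = circle_point n k"
  by (simp add: circle_point_def)

lemma circle_point_zero: "n \<ge> 1 \<Longrightarrow> circle_point n 0 = -1"
  by (simp add: circle_point_def)

lemma circle_point_last: "n \<ge> 1 \<Longrightarrow> circle_point n (2 * n - 1) = int n"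
  by (simp add: circle_point_def Let_def)

text \<open>Half a turn is negation of labels. This later limits an interval without antipodal pairs
  to at most \<open>n\<close> points.\<close>

lemma circle_point_antipode:
  assumes "n \<ge> 1"
  shows "circle_point n (k + n) = - circle_point n k"
proof -
  define r where "r = k mod (2 * n)"
  have r: "r < 2 * n" using assms by (simp add: r_def)
  have "(k + n) mod (2 * n) = (r + n) mod (2 * n)"
    by (simp add: r_def mod_add_left_eq)
  also have "\<dots> = (if r < n then r + n else r - n)"
    using r by (auto simp: mod_if)
  finally show ?thesis
    using r by (auto simp: circle_point_def Let_def simp flip: r_def)
qed

lemma circle_point_in: "n \<ge> 1 \<Longrightarrow> circle_point n k \<in> {- int n..int n} - {0}"
  using mod_less_divisor[of "2 * n" k] by (auto simp: circle_point_def Let_def simp del: mod_less_divisor)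

lemma ccw_permutes:
  assumes "n \<ge> 1"
  shows "ccw n permutes ({- int n..int n} - {0})"
proof (rule bij_imp_permutes)
  \<comment> \<open>The inverse is the clockwise step. At 0 and off the circle \<open>ccw n\<close>
    is the identity, as \<open>permutes\<close> requires.\<close>
  show "bij_betw (ccw n) ({- int n..int n} - {0}) ({- int n..int n} - {0})"
    by (rule bij_betwI[where g = "\<lambda>a. if a = int n then -1 else if a = - int n then 1
        else if a > 0 then a + 1 else a - 1"])
      (use assms in \<open>auto simp: ccw_def split: if_splits\<close>)
qed (use assms in \<open>auto simp: ccw_def\<close>)

lemma ccw_minus: "ccw n (- a) = - ccw n a"
  by (auto simp: ccw_def)

lemma ccw_comp_hyperoctahedral:
  "n \<ge> 1 \<Longrightarrow> \<pi> \<in> hyperoctahedral n \<Longrightarrow> ccw n \<circ> \<pi> \<in> hyperoctahedral n"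
  by (auto simp: hyperoctahedral_def ccw_minus ccw_permutes intro: permutes_compose)

lemma circle_interval_ccw:
  assumes "n \<ge> 1" "circle_interval n A"
  shows "circle_interval n (ccw n ` A)"
proof -
  obtain s l where A: "A = (\<lambda>i. circle_point n (s + i)) ` {..<l}"
    using assms(2) by (auto simp: circle_interval_def)
  \<comment> \<open>The starting index moves back by one; the added period \<open>2 * n\<close>
    keeps the subtraction from truncating at \<open>s = 0\<close>.\<close>
  have "ccw n (circle_point n (s + i)) = circle_point n (s + 2 * n - 1 + i)" for i
  proof -
    have "Suc (s + 2 * n - 1 + i) = s + i + 2 * n" using assms(1) by simp
    then show ?thesis
      using circle_point_ccw[OF assms(1), of "s + 2 * n - 1 + i"] circle_point_add_period by metis
  qed
  then have "ccw n ` A = (\<lambda>i. circle_point n (s + 2 * n - 1 + i)) ` {..<l}"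
    by (simp add: A image_image)
  then show ?thesis by (auto simp: circle_interval_def)
qed

lemma finite_B_arc_perms: "finite (B_arc_perms n)"
  by (rule finite_subset[OF _ finite_permutations[of "{- int n..int n} - {0}"]])
    (auto simp: B_arc_perms_def hyperoctahedral_def)

lemma ccw_comp_bij_B_arc_perms:
  assumes "n \<ge> 1"
  shows "bij_betw ((\<circ>) (ccw n)) (B_arc_perms n) (B_arc_perms n)"
proof -
  have inj: "inj_on ((\<circ>) (ccw n)) (B_arc_perms n)"
    using fun.inj_map[OF permutes_inj[OF ccw_permutes[OF assms]]] by (auto intro: inj_on_subset)
  have "(\<circ>) (ccw n) ` B_arc_perms n \<subseteq> B_arc_perms n"
  proof clarify
    fix \<pi> assume \<pi>: "\<pi> \<in> B_arc_perms n"
    have "circle_interval n ((\<lambda>i. (ccw n \<circ> \<pi>) (int i)) ` {j..n})" if "j \<in> {1..n}" for j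
      using circle_interval_ccw[OF assms, of "(\<lambda>i. \<pi> (int i)) ` {j..n}"] that \<pi>
      by (auto simp: B_arc_perms_def image_image)
    then show "ccw n \<circ> \<pi> \<in> B_arc_perms n"
      using \<pi> assms ccw_comp_hyperoctahedral by (auto simp: B_arc_perms_def)
  qed
  \<comment> \<open>An injective self-map of a finite set is onto, so closure under the step in one
    direction suffices.\<close>
  then show ?thesis
    using inj endo_inj_surj[OF finite_B_arc_perms] by (simp add: bij_betw_def)
qed

lemma ccw_comp_bij_arcs_ending:
  assumes "n \<ge> 1"
  shows "bij_betw ((\<circ>) (ccw n)) (arcs_ending n a) (arcs_ending n (ccw n a))"
proof -
  have inj: "inj (ccw n)" using permutes_inj[OF ccw_permutes[OF assms]] .
  have bij: "bij_betw ((\<circ>) (ccw n)) (B_arc_perms n) (B_arc_perms n)"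
    using ccw_comp_bij_B_arc_perms[OF assms] .
  have "(\<circ>) (ccw n) ` arcs_ending n a = arcs_ending n (ccw n a)"
  proof (intro equalityI subsetI)
    fix \<pi> assume \<pi>: "\<pi> \<in> arcs_ending n (ccw n a)"
    then obtain \<tau> where "\<tau> \<in> B_arc_perms n" "\<pi> = ccw n \<circ> \<tau>"
      using bij by (auto simp: arcs_ending_def bij_betw_def)
    moreover from this \<pi> have "\<tau> (int n) = a"
      using inj by (auto simp: arcs_ending_def inj_eq)
    ultimately show "\<pi> \<in> (\<circ>) (ccw n) ` arcs_ending n a" by (auto simp: arcs_ending_def)
  qed (use bij in \<open>auto simp: arcs_ending_def bij_betw_def\<close>)
  then show ?thesis
    using bij by (auto simp: bij_betw_def arcs_ending_def intro: inj_on_subset)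
qed

section \<open>Elementary properties of signed permutations\<close>

context
  fixes n :: nat and \<pi> :: "int \<Rightarrow> int"
  assumes \<pi>: "\<pi> \<in> hyperoctahedral n"
begin

lemma hyperoctahedral_inj: "\<pi> a = \<pi> b \<longleftrightarrow> a = b"
  using \<pi> permutes_inj[of \<pi>] by (auto simp: hyperoctahedral_def inj_eq)

lemma hyperoctahedral_minus: "\<pi> (- a) = - \<pi> a"
  using \<pi> by (simp add: hyperoctahedral_def)

lemma hyperoctahedral_abs_eq_iff: "\<bar>\<pi> (int i)\<bar> = \<bar>\<pi> (int j)\<bar> \<longleftrightarrow> i = j"
proof
  assume "\<bar>\<pi> (int i)\<bar> = \<bar>\<pi> (int j)\<bar>"
  then have "\<pi> (int i) = \<pi> (int j) \<or> \<pi> (int i) = \<pi> (- int j)"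
    by (auto simp: hyperoctahedral_minus abs_eq_iff)
  then show "i = j" by (auto simp: hyperoctahedral_inj)
qed simp

lemma hyperoctahedral_in: "i \<in> {1..n} \<Longrightarrow> \<pi> (int i) \<in> {- int n..int n} - {0}"
  using \<pi> permutes_in_image[of \<pi> "{- int n..int n} - {0}" "int i"]
  by (auto simp: hyperoctahedral_def)

text \<open>The position of the entry \<open>1\<close> or \<open>-1\<close> is the only one where a
  counterclockwise step flips a sign; the changes of all statistics are computed around it.\<close>

lemma hyperoctahedral_unit_index:
  assumes "n \<ge> 1"
  obtains i where "i \<in> {1..n}" "\<bar>\<pi> (int i)\<bar> = 1"
proof -
  have "\<pi> ` ({- int n..int n} - {0}) = {- int n..int n} - {0}"
    using \<pi> by (intro permutes_image) (simp add: hyperoctahedral_def)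
  moreover have "1 \<in> {- int n..int n} - {0}" using assms by simp
  ultimately obtain a where a: "a \<in> {- int n..int n} - {0}" "\<pi> a = 1"
    by (metis imageE)
  have "\<bar>\<pi> (int (nat \<bar>a\<bar>))\<bar> = 1"
    using a hyperoctahedral_minus[of a] by (cases "a > 0") auto
  moreover have "nat \<bar>a\<bar> \<in> {1..n}"
    using a(1) by (auto simp: abs_if nat_le_iff)
  ultimately show thesis by (rule that[rotated])
qed

end

section \<open>Effect of one rotation step on \<open>inversions\<close>, \<open>neg\<close> and
  \<open>maj\<close>\<close>

text \<open>The minimum at position \<open>i\<close> is inverted with exactly the
  \<open>i - 1\<close> positions to its left, and the maximum that replaces it with the
  \<open>n - i\<close> positions to its right. Pairs avoiding \<open>i\<close> keep their relative
  order. Adding \<open>i - 1\<close> on the left avoids a difference of naturals.\<close>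

lemma inversions_cycle:
  assumes i: "i \<in> {1..n}" "\<sigma> i = 1" "\<tau> i = n"
    and other: "\<And>k. k \<in> {1..n} \<Longrightarrow> k \<noteq> i \<Longrightarrow> 1 < \<sigma> k \<and> \<sigma> k \<le> n \<and> \<tau> k = \<sigma> k - 1"
  shows "inversions n \<tau> + (i - 1) = inversions n \<sigma> + (n - i)"
proof -
  \<comment> \<open>The inversions that avoid position \<open>i\<close>, common to \<sigma> and
    \<tau>.\<close>
  define R where
    "R = {(j, k). 1 \<le> j \<and> j < k \<and> k \<le> n \<and> j \<noteq> i \<and> k \<noteq> i \<and> \<sigma> j > \<sigma> k}"
  have fin: "finite R"
    by (rule finite_subset[of _ "{1..n} \<times> {1..n}"]) (auto simp: R_def)
  have \<sigma>_gt: "\<sigma> k > 1" if "k \<in> {1..n}" "k \<noteq> i" for k using other that by blast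
  have \<tau>_lt: "\<tau> k < n" if "k \<in> {1..n}" "k \<noteq> i" for k using other[OF that] by linarith
  have \<tau>_less: "\<tau> k < \<tau> j \<longleftrightarrow> \<sigma> k < \<sigma> j" if "j \<in> {1..n}" "j \<noteq> i" "k \<in> {1..n}" "k \<noteq> i" for j k
    using other[OF that(1,2)] other[OF that(3,4)] by linarith
  have "{(j, k). 1 \<le> j \<and> j < k \<and> k \<le> n \<and> \<sigma> j > \<sigma> k} = R \<union> {1..<i} \<times> {i}"
  proof (rule set_eqI, clarify)
    fix j k
    show "(j, k) \<in> {(j, k). 1 \<le> j \<and> j < k \<and> k \<le> n \<and> \<sigma> j > \<sigma> k} \<longleftrightarrow> (j, k) \<in> R \<union> {1..<i} \<times> {i}"
      using i \<sigma>_gt[of j] \<sigma>_gt[of k] by (cases "j = i"; cases "k = i") (auto simp: R_def)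
  qed
  then have "inversions n \<sigma> = card R + (i - 1)"
    unfolding inversions_def using fin by (simp, subst card_Un_disjoint) (auto simp: R_def)
  moreover have "{(j, k). 1 \<le> j \<and> j < k \<and> k \<le> n \<and> \<tau> j > \<tau> k} = R \<union> {i} \<times> {i<..n}"
  proof (rule set_eqI, clarify)
    fix j k
    show "(j, k) \<in> {(j, k). 1 \<le> j \<and> j < k \<and> k \<le> n \<and> \<tau> j > \<tau> k} \<longleftrightarrow> (j, k) \<in> R \<union> {i} \<times> {i<..n}"
      using i \<tau>_lt[of j] \<tau>_lt[of k] \<tau>_less[of j k]
      by (cases "j = i"; cases "k = i") (auto simp: R_def)
  qed
  then have "inversions n \<tau> = card R + (n - i)"
    unfolding inversions_def using fin by (simp, subst card_Un_disjoint) (auto simp: R_def)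
  ultimately show ?thesis by simp
qed

lemma finite_Des: "finite (Des m \<tau>)"
  by (rule finite_subset[of _ "{..m}"]) (auto simp: Des_def)

text \<open>Powers of a sign see only parity, so a decrease of an exponent by one counts as an
  increase by one.\<close>

lemma power_eq_if_involution:
  fixes y :: "'a::comm_ring_1"
  assumes "y * y = 1" "even (a + b)"
  shows "y ^ a = y ^ b"
proof -
  have "y ^ c = (if even c then 1 else y)" for c
    using assms(1) by (induction c) auto
  then show ?thesis using assms(2) by auto
qed

context
  fixes n i :: nat and \<pi> :: "int \<Rightarrow> int"
  assumes \<pi>: "\<pi> \<in> hyperoctahedral n" and i: "i \<in> {1..n}" and unit: "\<bar>\<pi> (int i)\<bar> = 1"
begin

text \<open>No second entry has absolute value 1, so every other entry moves one unit toward 0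
  without reaching it, and thus keeps its sign.\<close>

lemma abs_gt_1_and_ccw:
  assumes "k \<in> {1..n}" "k \<noteq> i"
  shows "1 < \<bar>\<pi> (int k)\<bar>" "\<bar>\<pi> (int k)\<bar> \<le> int n" "ccw n (\<pi> (int k)) = \<pi> (int k) - sgn (\<pi> (int k))"
proof -
  have "\<bar>\<pi> (int k)\<bar> \<noteq> 1"
    using hyperoctahedral_abs_eq_iff[OF \<pi>, of k i] unit assms by simp
  then show *: "1 < \<bar>\<pi> (int k)\<bar>" "\<bar>\<pi> (int k)\<bar> \<le> int n"
    using hyperoctahedral_in[OF \<pi> assms(1)] by auto
  show "ccw n (\<pi> (int k)) = \<pi> (int k) - sgn (\<pi> (int k))"
    using * by (cases "\<pi> (int k) > 0") (auto simp: ccw_def)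
qed

lemma inversions_ccw:
  "inversions n (abs_perm (ccw n \<circ> \<pi>)) + (i - 1) = inversions n (abs_perm \<pi>) + (n - i)"
proof (rule inversions_cycle[OF i])
  show "abs_perm (ccw n \<circ> \<pi>) i = n" "abs_perm \<pi> i = 1"
    using unit by (auto simp: abs_perm_def ccw_def abs_if split: if_splits)
  fix k assume "k \<in> {1..n}" "k \<noteq> i"
  from abs_gt_1_and_ccw[OF this]
  show "1 < abs_perm \<pi> k \<and> abs_perm \<pi> k \<le> n
      \<and> abs_perm (ccw n \<circ> \<pi>) k = abs_perm \<pi> k - 1"
    by (cases "\<pi> (int k) > 0") (auto simp: abs_perm_def)
qed

lemma ccw_less_zero_iff:
  assumes "k \<in> {1..n}" "k \<noteq> i"
  shows "ccw n (\<pi> (int k)) < 0 \<longleftrightarrow> \<pi> (int k) < 0"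
  using abs_gt_1_and_ccw[OF assms] by (cases "\<pi> (int k) > 0") auto

lemma B_less_ccw_iff:
  assumes "j \<in> {1..n}" "j \<noteq> i" "k \<in> {1..n}" "k \<noteq> i"
  shows "B_less (ccw n (\<pi> (int j))) (ccw n (\<pi> (int k))) \<longleftrightarrow> B_less (\<pi> (int j)) (\<pi> (int k))"
  using abs_gt_1_and_ccw[OF assms(1,2)] abs_gt_1_and_ccw[OF assms(3,4)]
  by (cases "\<pi> (int j) > 0"; cases "\<pi> (int k) > 0") (auto simp: B_less_def)

text \<open>In the order used for descents, \<open>1\<close> lies above all negative and below all
  positive other entries. So does its image \<open>-n\<close> after the step, hence no comparison
  changes.\<close>

lemma fmaj_ccw_pos:
  assumes "\<pi> (int i) = 1"
  shows "neg n (ccw n \<circ> \<pi>) = Suc (neg n \<pi>)" "maj n (ccw n \<circ> \<pi>) = maj n \<pi>"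
proof -
  have *: "ccw n (\<pi> (int i)) = - int n" using assms by (simp add: ccw_def)
  have "{k \<in> {1..n}. (ccw n \<circ> \<pi>) (int k) < 0} = insert i {k \<in> {1..n}. \<pi> (int k) < 0}"
    using i * ccw_less_zero_iff by fastforce
  then show "neg n (ccw n \<circ> \<pi>) = Suc (neg n \<pi>)" by (simp add: neg_def assms)
  have "B_less (ccw n (\<pi> (int (k + 1)))) (ccw n (\<pi> (int k)))
      \<longleftrightarrow> B_less (\<pi> (int (k + 1))) (\<pi> (int k))" if k: "1 \<le> k" "k \<le> n - 1" for k
  proof -
    have mem: "k \<in> {1..n}" "k + 1 \<in> {1..n}" using k by auto
    consider "k = i" | "k + 1 = i" | "k \<noteq> i" "k + 1 \<noteq> i" by blast
    then show ?thesis
    proof cases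
      case 1
      then show ?thesis using abs_gt_1_and_ccw[OF mem(2)] i assms *
        by (cases "\<pi> (int (k + 1)) > 0") (auto simp: B_less_def)
    next
      case 2
      then show ?thesis using abs_gt_1_and_ccw[OF mem(1)] i assms *
        by (cases "\<pi> (int k) > 0") (auto simp: B_less_def)
    next
      case 3
      then show ?thesis using B_less_ccw_iff mem by blast
    qed
  qed
  then have "Des n (ccw n \<circ> \<pi>) = Des n \<pi>" by (auto simp: Des_def)
  then show "maj n (ccw n \<circ> \<pi>) = maj n \<pi>" by (simp add: maj_def)
qed

text \<open>Here the least label \<open>-1\<close> becomes the greatest label \<open>n\<close>. A
  descent just before \<open>i\<close> disappears and one at \<open>i\<close> appears, so
  \<open>maj\<close> grows by 1 while \<open>neg\<close> drops by 1, a net gain of 1 in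
  \<open>fmaj\<close>. A descent at \<open>i\<close> requires a next entry, whence
  \<open>i \<noteq> n\<close>.\<close>

lemma fmaj_ccw_neg:
  assumes "\<pi> (int i) = -1" "i \<noteq> n"
  shows "Suc (neg n (ccw n \<circ> \<pi>)) = neg n \<pi>" "maj n (ccw n \<circ> \<pi>) = Suc (maj n \<pi>)"
proof -
  have *: "ccw n (\<pi> (int i)) = int n" using assms by (simp add: ccw_def)
  have "{k \<in> {1..n}. \<pi> (int k) < 0} = insert i {k \<in> {1..n}. (ccw n \<circ> \<pi>) (int k) < 0}"
    using i * assms(1) ccw_less_zero_iff by fastforce
  then show "Suc (neg n (ccw n \<circ> \<pi>)) = neg n \<pi>" by (simp add: neg_def *)
  have Des_iff: "k \<in> Des n \<pi> \<longleftrightarrow> k \<noteq> i \<and> (k + 1 = i \<or> k \<in> Des n (ccw n \<circ> \<pi>))"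
    "k \<in> Des n (ccw n \<circ> \<pi>) \<Longrightarrow> k + 1 \<noteq> i"
    if k: "1 \<le> k" "k \<le> n - 1" for k
  proof -
    have mem: "k \<in> {1..n}" "k + 1 \<in> {1..n}" using k by auto
    consider "k = i" | "k + 1 = i" | "k \<noteq> i" "k + 1 \<noteq> i" by blast
    then have "(k \<in> Des n \<pi> \<longleftrightarrow> k \<noteq> i \<and> (k + 1 = i \<or> k \<in> Des n (ccw n \<circ> \<pi>)))
        \<and> (k \<in> Des n (ccw n \<circ> \<pi>) \<longrightarrow> k + 1 \<noteq> i)"
    proof cases
      case 1
      then show ?thesis using abs_gt_1_and_ccw[OF mem(2)] assms * k
        by (cases "\<pi> (int (k + 1)) > 0") (auto simp: B_less_def Des_def)
    next
      case 2
      then show ?thesis using abs_gt_1_and_ccw[OF mem(1)] assms * k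
        by (cases "\<pi> (int k) > 0") (auto simp: B_less_def Des_def)
    next
      case 3
      then show ?thesis using B_less_ccw_iff[OF mem(2) _ mem(1)] k by (auto simp: Des_def)
    qed
    then show "k \<in> Des n \<pi> \<longleftrightarrow> k \<noteq> i \<and> (k + 1 = i \<or> k \<in> Des n (ccw n \<circ> \<pi>))"
      "k \<in> Des n (ccw n \<circ> \<pi>) \<Longrightarrow> k + 1 \<noteq> i" by blast+
  qed
  have i_Des: "i \<in> Des n (ccw n \<circ> \<pi>)"
    using i assms * abs_gt_1_and_ccw[of "i + 1"]
    by (cases "\<pi> (int (i + 1)) > 0") (auto simp: Des_def B_less_def)
  \<comment> \<open>The descents at neither \<open>i - 1\<close> nor \<open>i\<close>; they are the
    same before and after the step.\<close>
  define D where "D = Des n (ccw n \<circ> \<pi>) - {i}"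
  have D': "Des n (ccw n \<circ> \<pi>) = insert i D" "i \<notin> D" "finite D"
    using i_Des finite_Des by (auto simp: D_def)
  have range: "1 \<le> k \<and> k \<le> n - 1" if "k \<in> Des n \<tau>" for k \<tau>
    using that by (simp add: Des_def)
  have Des_D: "k \<in> Des n \<pi> \<longleftrightarrow> 1 \<le> k \<and> k \<le> n - 1 \<and> (k + 1 = i \<or> k \<in> D)" for k
    using Des_iff(1)[of k] range[of k] by (auto simp: D_def)
  \<comment> \<open>The summand \<open>i - 1\<close> is the descent before position
    \<open>i\<close>. For \<open>i = 1\<close> there is no such descent and the summand is 0, so the
    formula still holds.\<close>
  have "\<Sum> (Des n \<pi>) = i - 1 + \<Sum> D"
  proof (cases "i = 1")
    case True
    then have "Des n \<pi> = D" using Des_D range by (auto simp: D_def)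
    then show ?thesis using True by simp
  next
    case False
    then have "1 \<le> i - 1" "i - 1 \<le> n - 1" "i - 1 + 1 = i" using i by auto
    moreover from this have "i - 1 \<notin> D" using Des_iff(2)[of "i - 1"] by (auto simp: D_def)
    moreover from calculation have "Des n \<pi> = insert (i - 1) D"
      using Des_D range by (auto simp: D_def)
    ultimately show ?thesis using D' by simp
  qed
  then show "maj n (ccw n \<circ> \<pi>) = Suc (maj n \<pi>)" using D' i by (simp add: maj_def)
qed

end

text \<open>The number of inversions changes by \<open>(n - i) - (i - 1)\<close>, which has the
  parity of \<open>n - 1\<close> wherever the entry of absolute value 1 stands. \<open>neg\<close>
  changes by 1 in either direction, and \<open>fmaj\<close> grows by exactly 1.\<close>

lemma weight_ccw:
  fixes x y q :: "'a::comm_ring_1"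
  assumes "n \<ge> 1" "\<pi> \<in> hyperoctahedral n" "\<pi> (int n) \<noteq> -1" "x * x = 1" "y * y = 1"
  shows "weight x y q n (ccw n \<circ> \<pi>) = x * y ^ (n - 1) * q * weight x y q n \<pi>"
proof -
  obtain i where i: "i \<in> {1..n}" "\<bar>\<pi> (int i)\<bar> = 1"
    using hyperoctahedral_unit_index[OF assms(2,1)] .
  have "y ^ inversions n (abs_perm (ccw n \<circ> \<pi>)) = y ^ (n - 1 + inversions n (abs_perm \<pi>))"
  proof (rule power_eq_if_involution[OF assms(5)])
    have "inversions n (abs_perm (ccw n \<circ> \<pi>)) + (n - 1 + inversions n (abs_perm \<pi>))
        = 2 * (inversions n (abs_perm \<pi>) + (n - i))"
      using inversions_ccw[OF assms(2) i] i by auto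
    then show "even (inversions n (abs_perm (ccw n \<circ> \<pi>)) + (n - 1 + inversions n (abs_perm \<pi>)))"
      by (metis dvd_triv_left)
  qed
  moreover have "x ^ neg n (ccw n \<circ> \<pi>) = x ^ Suc (neg n \<pi>) \<and> fmaj n (ccw n \<circ> \<pi>) = Suc (fmaj n \<pi>)"
  proof (cases "\<pi> (int i) = 1")
    case True
    then show ?thesis using fmaj_ccw_pos[OF assms(2) i] by (simp add: fmaj_def)
  next
    case False
    then have "\<pi> (int i) = -1" "i \<noteq> n" using i assms(3) by auto
    note * = fmaj_ccw_neg[OF assms(2) i this]
    have "x ^ neg n (ccw n \<circ> \<pi>) = x ^ Suc (neg n \<pi>)"
      by (rule power_eq_if_involution[OF assms(4)]) (simp flip: *(1))
    then show ?thesis using * by (simp add: fmaj_def)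
  qed
  ultimately show ?thesis by (simp add: weight_def power_add mult_ac)
qed

section \<open>Summing along the rotation orbits\<close>

text \<open>The bound on \<open>p\<close> keeps the last entry \<open>circle_point n (Suc p)\<close>
  away from \<open>-1\<close>, the label of index 0, so \<open>weight_ccw\<close> applies to every
  summand.\<close>

lemma sum_arcs_ending_Suc:
  fixes x y q :: "'a::comm_ring_1"
  assumes "n \<ge> 1" "x * x = 1" "y * y = 1" "Suc p < 2 * n"
  shows "sum (weight x y q n) (arcs_ending n (circle_point n p))
    = x * y ^ (n - 1) * q * sum (weight x y q n) (arcs_ending n (circle_point n (Suc p)))"
proof -
  have "circle_point n (Suc p) \<noteq> -1"
    using assms(4) by (auto simp: circle_point_def Let_def)
  then have *: "weight x y q n (ccw n \<circ> \<pi>) = x * y ^ (n - 1) * q * weight x y q n \<pi>"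
    if "\<pi> \<in> arcs_ending n (circle_point n (Suc p))" for \<pi>
    using that by (intro weight_ccw assms) (auto simp: arcs_ending_def B_arc_perms_def)
  have "sum (weight x y q n) (arcs_ending n (circle_point n p))
      = (\<Sum>\<pi>\<in>arcs_ending n (circle_point n (Suc p)). weight x y q n (ccw n \<circ> \<pi>))"
    using ccw_comp_bij_arcs_ending[OF assms(1), of "circle_point n (Suc p)"]
    by (simp add: sum.reindex_bij_betw circle_point_ccw[OF assms(1)])
  also have "\<dots> = x * y ^ (n - 1) * q * sum (weight x y q n) (arcs_ending n (circle_point n (Suc p)))"
    by (simp add: * sum_distrib_left)
  finally show ?thesis .
qed

text \<open>The label \<open>n\<close> has index \<open>2 * n - 1\<close>, so
  \<open>2 * n - Suc k\<close> is the index reached from it by \<open>k\<close> counterclockwise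
  steps, each contributing one factor.\<close>

lemma sum_arcs_ending:
  fixes x y q :: "'a::comm_ring_1"
  assumes "n \<ge> 1" "x * x = 1" "y * y = 1" "k < 2 * n"
  shows "sum (weight x y q n) (arcs_ending n (circle_point n (2 * n - Suc k)))
    = (x * y ^ (n - 1) * q) ^ k * sum (weight x y q n) (arcs_ending n (int n))"
  using assms(4)
proof (induction k)
  case 0
  then show ?case using circle_point_last[OF assms(1)] by simp
next
  case (Suc k)
  then have "Suc (2 * n - Suc (Suc k)) = 2 * n - Suc k" by simp
  then show ?case
    using sum_arcs_ending_Suc[OF assms(1-3), of "2 * n - Suc (Suc k)" q] Suc
    by (simp add: mult.assoc)
qed

lemma circle_point_bij:
  assumes "n \<ge> 1"
  shows "bij_betw (circle_point n) {..<2 * n} ({- int n..int n} - {0})"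
  unfolding bij_betw_def
proof
  show "inj_on (circle_point n) {..<2 * n}"
    by (auto simp: inj_on_def circle_point_def Let_def split: if_splits)
  have "a \<in> circle_point n ` {..<2 * n}" if "a \<in> {- int n..int n} - {0}" for a
  proof (cases "a < 0")
    case True
    then have "a = circle_point n (nat (- a - 1))" "nat (- a - 1) < 2 * n"
      using that by (auto simp: circle_point_def Let_def)
    then show ?thesis by blast
  next
    case False
    then have "nat (a + int n - 1) < 2 * n" using that by auto
    moreover from this have "a = circle_point n (nat (a + int n - 1))"
      using that False by (auto simp: circle_point_def Let_def)
    ultimately show ?thesis by blast
  qed
  then show "circle_point n ` {..<2 * n} = {- int n..int n} - {0}"
    using circle_point_in[OF assms] by (intro equalityI image_subsetI subsetI)
qed

lemma sum_B_arc_perms: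
  fixes x y q :: "'a::comm_ring_1"
  assumes "n \<ge> 1" "x * x = 1" "y * y = 1"
  shows "sum (weight x y q n) (B_arc_perms n)
    = q_bracket (2 * n) (x * y ^ (n - 1) * q) * sum (weight x y q n) (arcs_ending n (int n))"
proof -
  have last: "(\<lambda>\<pi>. \<pi> (int n)) ` B_arc_perms n \<subseteq> {- int n..int n} - {0}"
    using hyperoctahedral_in[of _ n n] assms(1) by (force simp: B_arc_perms_def)
  \<comment> \<open>Split by the last entry, which can be any label on the circle.\<close>
  have "sum (weight x y q n) (B_arc_perms n)
      = (\<Sum>a\<in>{- int n..int n} - {0}. sum (weight x y q n) (arcs_ending n a))"
    unfolding arcs_ending_def
    by (rule sum.group[OF finite_B_arc_perms _ last, symmetric]) simp
  also have "\<dots> = (\<Sum>k<2 * n. sum (weight x y q n) (arcs_ending n (circle_point n k)))"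
    by (rule sum.reindex_bij_betw[OF circle_point_bij[OF assms(1)],
          where g = "\<lambda>a. sum (weight x y q n) (arcs_ending n a)", symmetric])
  \<comment> \<open>Reversing the order of summation makes \<open>k\<close> count the steps away
    from the label \<open>n\<close>, which produces the geometric sum.\<close>
  also have "\<dots> = (\<Sum>k<2 * n. sum (weight x y q n) (arcs_ending n (circle_point n (2 * n - Suc k))))"
    by (rule sum.nat_diff_reindex[symmetric])
  also have "\<dots> = (\<Sum>k<2 * n. (x * y ^ (n - 1) * q) ^ k * sum (weight x y q n) (arcs_ending n (int n)))"
    by (rule sum.cong) (use sum_arcs_ending[OF assms] in auto)
  finally show ?thesis by (simp add: q_bracket_def sum_distrib_right)
qed

section \<open>Intervals that touch the boundary between \<open>n\<close> and
  \<open>-1\<close>\<close>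

text \<open>The boundary lies just before index \<open>2 * n\<close>: starting \<open>a\<close>
  steps earlier runs up to \<open>n\<close> and then wraps to \<open>-1\<close>. Since
  \<open>a\<close> and \<open>b\<close> are at most \<open>n\<close>, each side stays within one
  sign and is a range of integers.\<close>

lemma arc_eq_image:
  assumes "a \<le> n" "b \<le> n"
  shows "arc n a b = (\<lambda>i. circle_point n (2 * n - a + i)) ` {..<a + b}"
proof -
  have low: "circle_point n (2 * n - a + i) = int n + 1 - int a + int i" if "i < a" for i
    using that assms by (auto simp: circle_point_def Let_def)
  have high: "circle_point n (2 * n - a + (a + i)) = - int i - 1" if "i < b" for i
  proof -
    have "2 * n - a + (a + i) = i + 2 * n" using assms by simp
    then show ?thesis using that assms by (simp add: circle_point_def Let_def)
  qed
  have "{..<a + b} = {..<a} \<union> (+) a ` {..<b}"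
    by (simp add: lessThan_atLeast0 ivl_disj_un_two(3) add.commute)
  then have "(\<lambda>i. circle_point n (2 * n - a + i)) ` {..<a + b}
      = (\<lambda>i. int n + 1 - int a + int i) ` {..<a} \<union> (\<lambda>i. - int i - 1) ` {..<b}"
    by (simp only: image_Un image_image, intro arg_cong2[of _ _ _ _ "(\<union>)"] image_cong refl) (use low high in auto)
  also have "(\<lambda>i. int n + 1 - int a + int i) ` {..<a} = {int n + 1 - int a..int n}"
  proof (intro equalityI subsetI)
    fix z assume z: "z \<in> {int n + 1 - int a..int n}"
    show "z \<in> (\<lambda>i. int n + 1 - int a + int i) ` {..<a}"
      by (rule image_eqI[of _ _ "nat (z - (int n + 1 - int a))"]) (use z in auto)
  qed auto
  also have "(\<lambda>i. - int i - 1) ` {..<b} = {- int b..-1}"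
  proof (intro equalityI subsetI)
    fix z assume z: "z \<in> {- int b..-1}"
    show "z \<in> (\<lambda>i. - int i - 1) ` {..<b}"
      by (rule image_eqI[of _ _ "nat (- z - 1)"]) (use z in auto)
  qed auto
  finally show ?thesis by (auto simp: arc_def)
qed

lemma circle_interval_arc: "a \<le> n \<Longrightarrow> b \<le> n \<Longrightarrow> circle_interval n (arc n a b)"
  using arc_eq_image[of a n b] unfolding circle_interval_def by blast

text \<open>Freedom from antipodes bounds the length by \<open>n\<close>, and containing
  \<open>n\<close> or \<open>-1\<close> forces the interval to touch the boundary. Both hold for the
  tails of arc permutations considered below.\<close>

lemma circle_interval_imp_arc:
  assumes "n \<ge> 1" "circle_interval n A" "\<And>z. z \<in> A \<Longrightarrow> - z \<notin> A" "int n \<in> A \<or> -1 \<in> A"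
  obtains a b where "a \<le> n" "b \<le> n" "A = arc n a b"
proof -
  obtain s' l where "A = (\<lambda>i. circle_point n (s' + i)) ` {..<l}"
    using assms(2) by (auto simp: circle_interval_def)
  moreover define s where "s = s' mod (2 * n)"
  ultimately have A: "A = (\<lambda>i. circle_point n (s + i)) ` {..<l}"
    by (simp add: circle_point_def mod_add_left_eq)
  have s: "s < 2 * n" using assms(1) by (simp add: s_def)
  \<comment> \<open>A longer interval would contain the points at offsets 0 and \<open>n\<close>,
    which are antipodal.\<close>
  have l: "l \<le> n"
  proof (rule ccontr)
    assume "\<not> l \<le> n"
    then have "0 \<in> {..<l}" "n \<in> {..<l}" by auto
    then have "circle_point n (s + 0) \<in> A" "circle_point n (s + n) \<in> A"
      unfolding A by (simp_all only: image_eqI)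
    then show False using assms(3) circle_point_antipode[OF assms(1), of s] by auto
  qed
  show thesis
  proof (cases "s = 0")
    case True
    then have "A = arc n 0 l"
      using l circle_point_add_period[of n] by (simp add: A arc_eq_image add.commute)
    then show thesis using that[of 0 l] l by simp
  next
    case False
    \<comment> \<open>An interval that does not start at \<open>-1\<close> can meet \<open>n\<close>
      or \<open>-1\<close> only by running on through index \<open>2 * n - 1\<close>. Hence its
      first \<open>2 * n - s\<close> points lie before the boundary and the rest after it.\<close>
    obtain i where i: "i < l" "circle_point n (s + i) = int n \<or> circle_point n (s + i) = -1"
      using assms(4) by (auto simp: A)
    define r where "r = (s + i) mod (2 * n)"
    have "r < 2 * n" using assms(1) by (simp add: r_def)
    moreover have "int r = 2 * int n - 1 \<or> r = 0"
      using i(2) by (auto simp: circle_point_def Let_def simp flip: r_def split: if_splits)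
    moreover have "r = (if s + i < 2 * n then s + i else s + i - 2 * n)"
      using s i l by (auto simp: r_def mod_if)
    ultimately have "2 * n - s \<le> l"
      using i False s l by (auto split: if_splits)
    moreover have "2 * n - (2 * n - s) = s" "2 * n - s + (l - (2 * n - s)) = l"
      using s \<open>2 * n - s \<le> l\<close> by auto
    ultimately have "A = arc n (2 * n - s) (l - (2 * n - s))"
      using l by (simp add: A arc_eq_image)
    moreover have "2 * n - s \<le> n" "l - (2 * n - s) \<le> n"
      using l \<open>2 * n - s \<le> l\<close> by auto
    ultimately show thesis using that by blast
  qed
qed

section \<open>Passing between the circles for \<open>n\<close> and \<open>n + 1\<close>\<close>

text \<open>Elements are total functions fixing everything off the circle, so the smaller group is
  literally a stabilizer in the larger one; oddness takes care of the point
  \<open>-(n + 1)\<close>.\<close>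

lemma hyperoctahedral_Suc_iff:
  "\<pi> \<in> hyperoctahedral n \<longleftrightarrow> \<pi> \<in> hyperoctahedral (Suc n) \<and> \<pi> (int (Suc n)) = int (Suc n)"
proof
  assume "\<pi> \<in> hyperoctahedral n"
  then show "\<pi> \<in> hyperoctahedral (Suc n) \<and> \<pi> (int (Suc n)) = int (Suc n)"
    by (auto simp: hyperoctahedral_def intro: permutes_subset permutes_not_in)
next
  assume \<pi>: "\<pi> \<in> hyperoctahedral (Suc n) \<and> \<pi> (int (Suc n)) = int (Suc n)"
  then have "\<pi> (- int (Suc n)) = - int (Suc n)"
    using hyperoctahedral_minus[of \<pi> "Suc n"] by metis
  then have "\<pi> a = a" if "\<bar>a\<bar> = int (Suc n)" for a
  proof -
    have "a = int (Suc n) \<or> a = - int (Suc n)" using that by linarith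
    then show ?thesis using \<pi> \<open>\<pi> (- int (Suc n)) = _\<close> by metis
  qed
  moreover have "\<bar>a\<bar> = int (Suc n)"
    if "a \<in> ({- int (Suc n)..int (Suc n)} - {0}) - ({- int n..int n} - {0})" for a
    using that by auto
  moreover have "\<pi> permutes ({- int (Suc n)..int (Suc n)} - {0})"
    using \<pi> by (simp add: hyperoctahedral_def)
  ultimately have "\<pi> permutes ({- int n..int n} - {0})"
    using permutes_superset by blast
  then show "\<pi> \<in> hyperoctahedral n" using \<pi> by (simp add: hyperoctahedral_def)
qed

lemma hyperoctahedral_antipode_free:
  assumes "\<pi> \<in> hyperoctahedral n" "z \<in> (\<lambda>i. \<pi> (int i)) ` {j..m}" "j \<ge> 1"
  shows "- z \<notin> (\<lambda>i. \<pi> (int i)) ` {j..m}"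
proof
  assume "- z \<in> (\<lambda>i. \<pi> (int i)) ` {j..m}"
  then obtain i k where "i \<ge> j" "k \<ge> j" "\<pi> (int i) = - \<pi> (int k)" using assms(2) by auto
  then have "\<pi> (int i) = \<pi> (- int k)" by (simp add: hyperoctahedral_minus[OF assms(1)])
  then show False using hyperoctahedral_inj[OF assms(1)] \<open>i \<ge> j\<close> assms(3) by auto
qed

text \<open>Every tail contains the last entry \<open>n + 1\<close>, so on the larger circle it is
  an arc around the boundary. Removing or inserting \<open>n + 1\<close> changes \<open>a\<close> by
  one and keeps the arc shape. On the smaller circle, the tails touch the boundary precisely when
  the entry at \<open>n\<close> is one of the two points beside it.\<close>

lemma arcs_ending_Suc:
  assumes "n \<ge> 1"
  shows "arcs_ending (Suc n) (int (Suc n)) = arcs_ending n (int n) \<union> arcs_ending n (-1)"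
proof (intro equalityI subsetI)
  fix \<pi> assume \<pi>: "\<pi> \<in> arcs_ending (Suc n) (int (Suc n))"
  define S where "S m j = (\<lambda>i. \<pi> (int i)) ` {j..m}" for m j
  have \<pi>': "\<pi> \<in> hyperoctahedral (Suc n)" "\<pi> (int (Suc n)) = int (Suc n)"
    using \<pi> by (auto simp: arcs_ending_def B_arc_perms_def)
  then have \<pi>_n: "\<pi> \<in> hyperoctahedral n" by (rule hyperoctahedral_Suc_iff[THEN iffD2, OF conjI])
  have arc: "\<exists>a\<le>n. \<exists>b\<le>n. S n j = arc n a b" if j: "j \<in> {1..n}" for j
  proof -
    have S: "S (Suc n) j = insert (int (Suc n)) (S n j)"
      using j \<pi>'(2) by (simp add: S_def atLeastAtMostSuc_conv)
    have "S n j \<subseteq> {- int n..int n}"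
      using j hyperoctahedral_in[OF \<pi>_n] by (fastforce simp: S_def)
    then have bound: "int (Suc n) \<notin> S n j" "- int (Suc n) \<notin> S n j"
      by (auto dest!: subsetD)
    have "circle_interval (Suc n) (S (Suc n) j)"
      using \<pi> j by (auto simp: arcs_ending_def B_arc_perms_def S_def)
    then obtain a b where ab: "a \<le> Suc n" "b \<le> Suc n" "S (Suc n) j = arc (Suc n) a b"
      using circle_interval_imp_arc[of "Suc n" "S (Suc n) j"]
        hyperoctahedral_antipode_free[OF \<pi>'(1), of _ j "Suc n", folded S_def] j S
      by auto
    have "int (Suc n) \<in> arc (Suc n) a b" using ab S by auto
    then have a: "a \<ge> 1" by (auto simp: arc_def)
    \<comment> \<open>Without this label the negative side has at most \<open>n\<close> points and
      fits on the smaller circle.\<close>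
    have "- int (Suc n) \<notin> arc (Suc n) a b" 
      unfolding ab(3)[symmetric] S using bound(2) by simp
    then have b: "b \<le> n" using ab(2) by (auto simp: arc_def)
    have "S n j = arc (Suc n) a b - {int (Suc n)}" using ab(3) S bound(1) by blast
    also have "\<dots> = arc n (a - 1) b" using a by (auto simp: arc_def)
    finally have "S n j = arc n (a - 1) b" .
    moreover have "a - 1 \<le> n" using ab(1) by simp
    ultimately show ?thesis using b by blast
  qed
  then have "circle_interval n (S n j)" if "j \<in> {1..n}" for j
    using that circle_interval_arc by metis
  then have mem: "\<pi> \<in> B_arc_perms n" using \<pi>_n by (simp add: B_arc_perms_def S_def)
  obtain a b where "S n n = arc n a b" using arc[of n] assms by auto
  then have ab: "{\<pi> (int n)} = arc n a b" by (simp add: S_def)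
  \<comment> \<open>The tail at \<open>n\<close> is a single point, and any nonempty arc contains
    one of the two labels beside the boundary.\<close>
  have "int n \<in> arc n a b \<or> -1 \<in> arc n a b"
  proof (rule ccontr)
    assume "\<not> ?thesis"
    then have "arc n a b = {}" by (auto simp: arc_def)
    then show False using ab by auto
  qed
  then have "\<pi> (int n) = int n \<or> \<pi> (int n) = -1" by (auto simp flip: ab)
  then show "\<pi> \<in> arcs_ending n (int n) \<union> arcs_ending n (-1)"
    using mem by (auto simp: arcs_ending_def)
next
  fix \<pi> assume "\<pi> \<in> arcs_ending n (int n) \<union> arcs_ending n (-1)"
  then have \<pi>: "\<pi> \<in> B_arc_perms n" "\<pi> (int n) = int n \<or> \<pi> (int n) = -1"
    by (auto simp: arcs_ending_def)
  then have \<pi>': "\<pi> \<in> hyperoctahedral n" by (simp add: B_arc_perms_def)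
  then have Suc: "\<pi> \<in> hyperoctahedral (Suc n)" "\<pi> (int (Suc n)) = int (Suc n)"
    using hyperoctahedral_Suc_iff by blast+
  define S where "S m j = (\<lambda>i. \<pi> (int i)) ` {j..m}" for m j
  have "circle_interval (Suc n) (S (Suc n) j)" if j: "j \<in> {1..Suc n}" for j
  proof (cases "j = Suc n")
    case True
    then have "S (Suc n) j = arc (Suc n) 1 0" using Suc(2) by (auto simp: S_def arc_def)
    then show ?thesis using circle_interval_arc[of 1 "Suc n" 0] by simp
  next
    case False
    then have j: "1 \<le> j" "j \<le> n" using j by auto
    have "\<pi> (int n) \<in> S n j" using j by (auto simp: S_def)
    moreover have "circle_interval n (S n j)" using \<pi>(1) j by (auto simp: B_arc_perms_def S_def)
    moreover have "- z \<notin> S n j" if "z \<in> S n j" for z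
      using hyperoctahedral_antipode_free[OF \<pi>'] that j by (simp add: S_def)
    ultimately obtain a b where ab: "a \<le> n" "b \<le> n" "S n j = arc n a b"
      using circle_interval_imp_arc[OF assms, of "S n j"] \<pi>(2) by metis
    have "S (Suc n) j = insert (int (Suc n)) (S n j)"
      using j Suc(2) by (simp add: S_def atLeastAtMostSuc_conv)
    also have "\<dots> = arc (Suc n) (Suc a) b" using ab by (auto simp: arc_def)
    finally show ?thesis using circle_interval_arc[of "Suc a" "Suc n" b] ab by simp
  qed
  then show "\<pi> \<in> arcs_ending (Suc n) (int (Suc n))"
    using Suc by (simp add: arcs_ending_def B_arc_perms_def S_def)
qed

text \<open>The appended entry \<open>n + 1\<close> is positive and the largest in both orders, so
  it adds no negative entry, no inversion and no descent at \<open>n\<close>.\<close>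

lemma weight_Suc:
  assumes "n \<ge> 1" "\<pi> \<in> hyperoctahedral n"
  shows "weight x y q (Suc n) \<pi> = weight x y q n \<pi>"
proof -
  have last: "\<pi> (int (Suc n)) = int (Suc n)" using assms(2) hyperoctahedral_Suc_iff by blast
  have bound: "\<bar>\<pi> (int k)\<bar> \<le> int n" if "1 \<le> k" "k \<le> n" for k
    using hyperoctahedral_in[OF assms(2), of k] that by auto
  have "{k \<in> {1..Suc n}. \<pi> (int k) < 0} = {k \<in> {1..n}. \<pi> (int k) < 0}"
    using last by (auto simp: le_Suc_eq simp del: of_nat_Suc)
  then have "neg (Suc n) \<pi> = neg n \<pi>" by (simp add: neg_def)
  moreover have "\<not> abs_perm \<pi> (Suc n) < abs_perm \<pi> k" if "1 \<le> k" "k < Suc n" for k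
    using last bound[of k] that by (simp add: abs_perm_def del: of_nat_Suc)
  then have "{(j, k). 1 \<le> j \<and> j < k \<and> k \<le> Suc n \<and> abs_perm \<pi> j > abs_perm \<pi> k}
      = {(j, k). 1 \<le> j \<and> j < k \<and> k \<le> n \<and> abs_perm \<pi> j > abs_perm \<pi> k}"
    by (auto simp: le_Suc_eq)
  then have "inversions (Suc n) (abs_perm \<pi>) = inversions n (abs_perm \<pi>)"
    by (simp add: inversions_def)
  moreover have "\<not> B_less (\<pi> (int (Suc n))) (\<pi> (int n))"
    using last bound[of n] assms(1) by (auto simp: B_less_def)
  then have "Des (Suc n) \<pi> = Des n \<pi>"
  proof -
    assume "\<not> B_less (\<pi> (int (Suc n))) (\<pi> (int n))"
    then have "k \<in> Des (Suc n) \<pi> \<longleftrightarrow> k \<in> Des n \<pi>" for k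
      using assms(1) by (cases "k = n") (auto simp: Des_def)
    then show ?thesis by blast
  qed
  then have "maj (Suc n) \<pi> = maj n \<pi>" by (simp add: maj_def)
  ultimately show ?thesis by (simp add: weight_def fmaj_def)
qed

lemma arcs_ending_1: "arcs_ending 1 1 = {id}"
proof (intro equalityI subsetI)
  fix \<pi> assume \<pi>: "\<pi> \<in> arcs_ending 1 1"
  then have *: "\<pi> permutes ({-1..1} - {0})" "\<pi> (- 1) = - \<pi> 1" "\<pi> 1 = 1"
    by (auto simp: arcs_ending_def B_arc_perms_def hyperoctahedral_def)
  have "\<pi> a = a" for a
  proof (cases "a \<in> {-1..1} - {0}")
    case True
    then have "a = 1 \<or> a = -1" by auto
    then show ?thesis using * by auto
  qed (use * permutes_not_in in metis)
  then show "\<pi> \<in> {id}" by auto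
next
  fix \<pi> :: "int \<Rightarrow> int" assume "\<pi> \<in> {id}"
  moreover have "circle_interval 1 {1}"
    using circle_interval_arc[of 1 1 0] by (simp add: arc_def)
  moreover have "(\<lambda>x. x) permutes ({-1..1} - {0 :: int})"
    using permutes_id by (simp add: id_def)
  ultimately show "\<pi> \<in> arcs_ending 1 1"
    by (auto simp: arcs_ending_def B_arc_perms_def hyperoctahedral_def permutes_id)
qed

lemma weight_1_id: "weight x y q 1 id = 1"
proof -
  have "neg 1 id = 0" by (auto simp: neg_def)
  moreover have "Des 1 id = {}" by (auto simp: Des_def)
  moreover have "{(j, k). 1 \<le> j \<and> j < k \<and> k \<le> 1 \<and> abs_perm id j > abs_perm id k} = {}" by auto
  ultimately show ?thesis by (simp only: weight_def fmaj_def maj_def inversions_def) simp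
qed

section \<open>The product formula and its four specializations\<close>

lemma sum_arcs_ending_eq_prod:
  fixes x y q :: "'a::comm_ring_1"
  assumes "n \<ge> 1" "x * x = 1" "y * y = 1"
  shows "sum (weight x y q n) (arcs_ending n (int n))
    = (\<Prod>i\<in>{1..n - 1}. 1 + x * y ^ (i - 1) * q ^ (2 * i - 1))"
  using assms(1)
proof (induction n rule: dec_induct)
  case base
  then show ?case using arcs_ending_1 weight_1_id[of x y q] by (simp add: id_def)
next
  case (step n)
  let ?z = "x * y ^ (n - 1) * q"
  have "sum (weight x y q (Suc n)) (arcs_ending (Suc n) (int (Suc n)))
      = sum (weight x y q n) (arcs_ending (Suc n) (int (Suc n)))"
  proof (rule sum.cong)
    fix \<pi> assume "\<pi> \<in> arcs_ending (Suc n) (int (Suc n))"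
    then have "\<pi> \<in> hyperoctahedral n"
      by (intro hyperoctahedral_Suc_iff[THEN iffD2]) (simp add: arcs_ending_def B_arc_perms_def)
    then show "weight x y q (Suc n) \<pi> = weight x y q n \<pi>" using weight_Suc step(1) by blast
  qed simp
  also have "\<dots> = sum (weight x y q n) (arcs_ending n (int n)) + sum (weight x y q n) (arcs_ending n (-1))"
    unfolding arcs_ending_Suc[OF step(1)] using step finite_B_arc_perms
    by (intro sum.union_disjoint) (auto simp: arcs_ending_def)
  \<comment> \<open>The label \<open>-1\<close> has index 0, which is \<open>2 * n - 1\<close> steps
    from \<open>n\<close>.\<close>
  also have "sum (weight x y q n) (arcs_ending n (-1))
      = ?z ^ (2 * n - 1) * sum (weight x y q n) (arcs_ending n (int n))"
    using sum_arcs_ending[OF step(1) assms(2,3), of "2 * n - 1" q] circle_point_zero[OF step(1)] step(1)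
    by simp
  also have "?z ^ (2 * n - 1) = (x * y ^ (n - 1)) ^ (2 * n - 1) * q ^ (2 * n - 1)"
    by (rule power_mult_distrib)
  \<comment> \<open>The sign factor squares to 1 and the exponent is odd.\<close>
  also have "(x * y ^ (n - 1)) ^ (2 * n - 1) = x * y ^ (n - 1)"
  proof -
    have "(x * y ^ (n - 1)) * (x * y ^ (n - 1)) = (x * x) * (y * y) ^ (n - 1)"
      by (simp add: power_mult_distrib mult_ac)
    then have "(x * y ^ (n - 1)) ^ (2 * n - 1) = (x * y ^ (n - 1)) ^ 1"
      using step(1) assms by (intro power_eq_if_involution) auto
    then show ?thesis by simp
  qed
  finally have "sum (weight x y q (Suc n)) (arcs_ending (Suc n) (int (Suc n)))
      = (1 + x * y ^ (n - 1) * q ^ (2 * n - 1)) * sum (weight x y q n) (arcs_ending n (int n))"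
    by (simp add: algebra_simps)
  moreover have "{1..Suc n - 1} = insert n {1..n - 1}" using step(1) by auto
  ultimately show ?case using step by simp
qed

lemma sum_weight_B_arc_perms:
  fixes x y q :: "'a::comm_ring_1"
  assumes "n \<ge> 1" "x * x = 1" "y * y = 1"
  shows "(\<Sum>\<pi>\<in>B_arc_perms n. x ^ neg n \<pi> * y ^ inversions n (abs_perm \<pi>) * q ^ fmaj n \<pi>)
    = q_bracket (2 * n) (x * y ^ (n - 1) * q)
      * (\<Prod>i\<in>{1..n - 1}. 1 + x * y ^ (i - 1) * q ^ (2 * i - 1))"
  using sum_B_arc_perms[OF assms] sum_arcs_ending_eq_prod[OF assms] by (simp add: weight_def)

theorem theorem5p8:
  fixes n :: nat and q :: "'a::comm_ring_1"
  assumes "n \<ge> 1"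
  shows "(\<Sum>\<pi>\<in>B_arc_perms n. q ^ fmaj n \<pi>)
           = q_bracket (2 * n) q * (\<Prod>i\<in>{1..n - 1}. 1 + q ^ (2 * i - 1))
    \<and> (\<Sum>\<pi>\<in>B_arc_perms n. of_int (B_sign n \<pi>) * q ^ fmaj n \<pi>)
           = q_bracket (2 * n) ((-1) ^ n * q)
             * (\<Prod>i\<in>{1..n - 1}. 1 + (-1) ^ i * q ^ (2 * i - 1))
    \<and> (\<Sum>\<pi>\<in>B_arc_perms n. (-1) ^ neg n \<pi> * q ^ fmaj n \<pi>)
           = q_bracket (2 * n) (- q) * (\<Prod>i\<in>{1..n - 1}. 1 - q ^ (2 * i - 1))
    \<and> (\<Sum>\<pi>\<in>B_arc_perms n. of_int (inv_sign n (abs_perm \<pi>)) * q ^ fmaj n \<pi>)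
           = q_bracket (2 * n) ((-1) ^ (n - 1) * q)
             * (\<Prod>i\<in>{1..n - 1}. 1 + (-1) ^ (i - 1) * q ^ (2 * i - 1))"
proof (intro conjI)
  \<comment> \<open>The pairs \<open>(x, y)\<close> equal to \<open>(1, 1)\<close>,
    \<open>(-1, -1)\<close>, \<open>(-1, 1)\<close> and \<open>(1, -1)\<close> turn the sign part of
    the weight into the four characters, in the order of the claims.\<close>
  note main = sum_weight_B_arc_perms[OF assms, of _ _ q]
  show "(\<Sum>\<pi>\<in>B_arc_perms n. q ^ fmaj n \<pi>)
      = q_bracket (2 * n) q * (\<Prod>i\<in>{1..n - 1}. 1 + q ^ (2 * i - 1))"
    using main[of 1 1] by simp
  \<comment> \<open>For \<open>x = y = -1\<close> the two signs merge; \<open>k \<ge> 1\<close>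
    matters because \<open>k - 1\<close> truncates at 0.\<close>
  have "(-1 :: 'a) * (-1) ^ (k - 1) = (-1) ^ k" if "k \<ge> 1" for k
    using that by (cases k) auto
  then have "(\<Prod>i\<in>{1..n - 1}. 1 + (-1) * (-1) ^ (i - 1) * q ^ (2 * i - 1))
      = (\<Prod>i\<in>{1..n - 1}. 1 + (-1) ^ i * q ^ (2 * i - 1))"
    "(-1 :: 'a) * (-1) ^ (n - 1) = (-1) ^ n"
    using assms by (auto intro!: prod.cong simp del: mult_minus1)
  then show "(\<Sum>\<pi>\<in>B_arc_perms n. of_int (B_sign n \<pi>) * q ^ fmaj n \<pi>)
      = q_bracket (2 * n) ((-1) ^ n * q) * (\<Prod>i\<in>{1..n - 1}. 1 + (-1) ^ i * q ^ (2 * i - 1))"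
    using main[of "-1" "-1"] by (simp add: B_sign_def inv_sign_def del: mult_minus1)
  show "(\<Sum>\<pi>\<in>B_arc_perms n. (-1) ^ neg n \<pi> * q ^ fmaj n \<pi>)
      = q_bracket (2 * n) (- q) * (\<Prod>i\<in>{1..n - 1}. 1 - q ^ (2 * i - 1))"
    using main[of "-1" 1] by simp
  show "(\<Sum>\<pi>\<in>B_arc_perms n. of_int (inv_sign n (abs_perm \<pi>)) * q ^ fmaj n \<pi>)
      = q_bracket (2 * n) ((-1) ^ (n - 1) * q)
        * (\<Prod>i\<in>{1..n - 1}. 1 + (-1) ^ (i - 1) * q ^ (2 * i - 1))"
    using main[of 1 "-1"] by (simp add: inv_sign_def)
qed

end
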